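(* Let $L \subset \mathbb{N}_{\ge 2}$ be a finite nonempty set and let $f \colon L \to \mathbb{N}$ be a map. Then there exist a numerical monoid $H$ and a squarefree element $a \in H$ such that \[ \mathsf L_H(a) = L \quad \text{and} \quad |\mathsf Z_{H,k}(a)| = f(k) \quad \text{for every } k \in L . \]
   Context: $\mathbb{N}$ denotes the positive integers, $\mathbb{N}_0 = \mathbb{N} \cup \{0\}$, and $\mathbb{N}_{\ge 2}$ the integers $\ge 2$. A numerical monoid is a submonoid of $(\mathbb{N}_0,+)$ whose complement in $\mathbb{N}_0$ is finite. An atom of $H$ is a nonzero element that is not a sum of two nonzero elements of $H$; $\mathcal A(H)$ is the set of atoms. The factorization monoid $\mathsf Z(H)$ is the (additively written) free abelian monoid with basis $\mathcal A(H)$, i.e. the finite formal sums $z = \sum_{u \in \mathcal A(H)} l_u u$ with $l_u \in \mathbb{N}_0$; its length is $|z| = \sum_u l_u$. The homomorphism $\pi \colon \mathsf Z(H) \to H$ evaluates a formal sum in $H$. For $a \in H$: $\mathsf Z_H(a) = \pi^{-1}(a)$ is the set of factorizations of $a$; $\mathsf Z_{H,k}(a) = \{ z \in \mathsf Z_H(a) : |z| = k\}$ for $k \in \mathbb{N}$; and $\mathsf L_H(a) = \{ |z| : z \in \mathsf Z_H(a) \} \subset \mathbb{N}_0$ is the set of lengths of $a$. An element $a \in H$ is squarefree if there are no nonzero $b \in H$ and $c \in H$ with $a = b + b + c$ (here $c = 0$ is allowed). *)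

theory Defs
  imports "HOL-Library.Multiset"
begin

definition numerical_monoid :: "nat set \<Rightarrow> bool" where
  "numerical_monoid H \<longleftrightarrow>
     0 \<in> H \<and> (\<forall>x\<in>H. \<forall>y\<in>H. x + y \<in> H) \<and> finite (- H)"

definition atoms :: "nat set \<Rightarrow> nat set" where
  "atoms H = {u \<in> H. u \<noteq> 0 \<and> \<not> (\<exists>x\<in>H. \<exists>y\<in>H. x \<noteq> 0 \<and> y \<noteq> 0 \<and> u = x + y)}"

text \<open>
  The free abelian monoid with basis \<open>A\<close>, written additively, is the monoid of finite
  multisets over \<open>A\<close>: the formal sum of the \<open>l\<^sub>u u\<close> is the multiset in which \<open>u\<close> occurs
  \<open>l\<^sub>u\<close> times. Its length is \<open>size\<close>, and the evaluation homomorphism is \<open>sum_mset\<close>.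
\<close>

definition factorization_monoid :: "nat set \<Rightarrow> nat multiset set" where
  "factorization_monoid H = {z. set_mset z \<subseteq> atoms H}"

definition factorizations :: "nat set \<Rightarrow> nat \<Rightarrow> nat multiset set" where
  "factorizations H a = {z \<in> factorization_monoid H. sum_mset z = a}"

definition factorizations_of_length :: "nat set \<Rightarrow> nat \<Rightarrow> nat \<Rightarrow> nat multiset set" where
  "factorizations_of_length H k a = {z \<in> factorizations H a. size z = k}"

definition length_set :: "nat set \<Rightarrow> nat \<Rightarrow> nat set" where
  "length_set H a = size ` factorizations H a"

text \<open>
  Squarefreeness is relative to the monoid \<open>H\<close>; it is unrelated to squarefreeness of \<open>a\<close>
  as an integer. The case \<open>c = 0\<close> is allowed.
\<close>

definition squarefree_in :: "nat set \<Rightarrow> nat \<Rightarrow> bool" where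
  "squarefree_in H a \<longleftrightarrow>
     a \<in> H \<and> \<not> (\<exists>b\<in>H. \<exists>c\<in>H. b \<noteq> 0 \<and> a = b + b + c)"

end

theory Submission
  imports Defs "HOL-Library.Disjoint_Sets"
begin

text \<open>
  Take one block for each factorization that is wanted: a set of as many positive integers as the
  factorization has atoms, the blocks being pairwise disjoint and all having the same sum \<open>A\<close>.
  If the numbers in the blocks are generic, in the sense that no multiset of them other than
  a block itself has sum \<open>A\<close>, then the blocks solve the problem. The monoid is generated by
  the numbers in the blocks together with all integers greater than \<open>A\<close>; the latter make the
  complement finite and are too large to occur in a factorization of \<open>A\<close>. Genericity alone makes
  each number \<open>u\<close> in a block an atom: a multiset of block elements with sum \<open>u\<close> can replace
  \<open>u\<close> in its block, and the result still has sum \<open>A\<close>, so it is again a block. As it shares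
  an element with the old one (blocks have at least two elements), nothing has changed. Likewise
  \<open>A = b + b + c\<close> with \<open>b \<noteq> 0\<close> would give a multiset with sum \<open>A\<close> and a repeated element.
  This is lemma \<open>numerical_monoid_from_blocks\<close>.

  Generic numbers are built in \<open>generic_block_numbers\<close> and \<open>generic_block_family\<close>. Let \<open>K\<close> be the
  product of the block sizes \<open>s i\<close>, and \<open>W\<close> a large power of a base \<open>b\<close>. Every element of block \<open>i\<close>
  is \<open>(K / s i) W\<close> plus a perturbation; each element gets its own power of \<open>b\<close>, smaller
  than \<open>W\<close>, and the zeroth element of the block compensates by subtracting the powers of its whole
  block. Thus each block has sum \<open>A = K W\<close>. Every element is at least \<open>W / 2\<close>, so the
  multiplicities in a multiset with sum \<open>A\<close> are at most \<open>2 K\<close>. For \<open>b > 2 K\<close> the sum can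
  be read off digit by digit, and the digits say that the multiplicity is constant on every block.
  Comparing with \<open>A\<close>, these constants add up to 1, so exactly one block is used, once.
\<close>

section \<open>Generic numbers in blocks with equal sums\<close>

text \<open>
  The leading digit \<open>d n\<close> is left unbounded: it will carry the coefficient of \<open>W\<close>, for which no
  estimate is then required.
\<close>

lemma base_expansion_eq_zeroD:
  fixes b :: int and d :: "nat \<Rightarrow> int"
  assumes "\<forall>p<n. \<bar>d p\<bar> < b" and "(\<Sum>p\<le>n. d p * b ^ p) = 0" and "p \<le> n"
  shows "d p = 0"
  using assms
proof (induction n arbitrary: d p)
  case 0
  then show ?case by simp
next
  case (Suc n)
  have split: "d 0 + b * (\<Sum>p\<le>n. d (Suc p) * b ^ p) = 0"
    using Suc.prems(2) unfolding sum.atMost_Suc_shift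
    by (simp add: sum_distrib_left algebra_simps)
  then have "d 0 = b * (- (\<Sum>p\<le>n. d (Suc p) * b ^ p))"
    by simp
  then have "b dvd d 0"
    by (rule dvdI)
  moreover have "\<bar>d 0\<bar> < b"
    using Suc.prems(1) by simp
  ultimately have d0: "d 0 = 0"
    using dvd_imp_le_int[of "d 0" b] by linarith
  have "b > 0"
    using \<open>\<bar>d 0\<bar> < b\<close> by simp
  then have "(\<Sum>p\<le>n. d (Suc p) * b ^ p) = 0"
    using split unfolding d0 by simp
  moreover have "\<forall>p<n. \<bar>d (Suc p)\<bar> < b"
    using Suc.prems(1) by simp
  ultimately have "\<And>q. q \<le> n \<Longrightarrow> d (Suc q) = 0"
    using Suc.IH[of "\<lambda>p. d (Suc p)"] by blast
  then show ?case
    using d0 Suc.prems(3) by (cases p) auto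
qed

lemma twice_sum_powers_le:
  fixes b :: int
  assumes "3 \<le> b"
  shows "2 * (\<Sum>q<n. b ^ q) \<le> b ^ n"
proof (induction n)
  case (Suc n)
  have "3 * b ^ n \<le> b * b ^ n"
    using assms by (intro mult_right_mono) auto
  then show ?case
    using Suc by simp
qed simp

text \<open>
  An integer relation between the numbers \<open>y\<close> whose total is a multiple of \<open>W\<close> is forced to be
  constant on blocks, as long as the coefficients in a block stay close to each other. Index
  \<open>(i, j)\<close> stands for element \<open>j\<close> of block \<open>i\<close>. The coefficients are integers, not just
  multiplicities, so that the lemma can also be applied to the difference of two elements.
\<close>

lemma generic_block_numbers:
  fixes s :: "'i \<Rightarrow> nat" and c :: "'i \<Rightarrow> int" and b :: int
  assumes "finite I" and "3 \<le> b" and c: "\<And>i. i \<in> I \<Longrightarrow> 1 \<le> c i"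
    and s: "\<And>i. i \<in> I \<Longrightarrow> 0 < s i"
  defines "T \<equiv> Sigma I (\<lambda>i. {..<s i})"
  shows "\<exists>W y. 0 < W \<and> (\<forall>t\<in>T. W \<le> 2 * y t) \<and>
           (\<forall>i\<in>I. (\<Sum>j<s i. y (i, j)) = c i * int (s i) * W) \<and>
           (\<forall>m E. (\<Sum>t\<in>T. m t * y t) = E * W \<longrightarrow>
              (\<forall>t\<in>T. \<bar>m t - m (fst t, 0)\<bar> < b) \<longrightarrow> (\<forall>t\<in>T. m t = m (fst t, 0)))"
proof -
  have "finite T"
    using assms by auto
  then obtain p where p: "bij_betw p T {..<card T}"
    using ex_bij_betw_finite_nat lessThan_atLeast0 by metis
  \<comment> \<open>The subtracted sum includes the power belonging to index \<open>0\<close> itself, so that this power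
    cancels there; this keeps the formula uniform at the cost of one digit that is always zero.\<close>
  define W where "W = b ^ card T"
  define y where "y = (\<lambda>t. c (fst t) * W + b ^ p t
      - (if snd t = 0 then \<Sum>l<s (fst t). b ^ p (fst t, l) else 0))"
  have pos: "W > 0"
    using assms by (simp add: W_def)
  have "W \<le> 2 * y t" if tT: "t \<in> T" for t
  proof -
    obtain i j where t: "t = (i, j)" and i: "i \<in> I"
      using tT by (auto simp: T_def)
    have inj: "inj_on (\<lambda>l. p (i, l)) {..<s i}" and sub: "(\<lambda>l. p (i, l)) ` {..<s i} \<subseteq> {..<card T}"
      using p i by (auto simp: T_def bij_betw_def inj_on_def)
    have "(\<Sum>l<s i. b ^ p (i, l)) = (\<Sum>q\<in>(\<lambda>l. p (i, l)) ` {..<s i}. b ^ q)"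
      using inj by (simp add: sum.reindex)
    also have "\<dots> \<le> (\<Sum>q<card T. b ^ q)"
      using sub assms by (intro sum_mono2) auto
    finally have "2 * (\<Sum>l<s i. b ^ p (i, l)) \<le> W"
      using twice_sum_powers_le[OF assms(2), of "card T"] by (simp add: W_def)
    moreover have "W \<le> c i * W"
      using c[OF i] pos by simp
    moreover have "c i * W - (\<Sum>l<s i. b ^ p (i, l)) \<le> y t"
    proof -
      have "0 \<le> b ^ p t" "0 \<le> (\<Sum>l<s i. b ^ p (i, l))"
        using assms by (auto intro: sum_nonneg)
      then show ?thesis
        by (auto simp: y_def t)
    qed
    ultimately show ?thesis
      by linarith
  qed
  moreover
  \<comment> \<open>The digit at the power belonging to \<open>(i, j)\<close> is the deviation of the coefficient there
    from the coefficient of the compensating element \<open>(i, 0)\<close>.\<close>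
  have block: "(\<Sum>j<s i. m (i, j) * y (i, j)) =
      (\<Sum>j<s i. m (i, j)) * c i * W + (\<Sum>j<s i. (m (i, j) - m (i, 0)) * b ^ p (i, j))"
    if i: "i \<in> I" for i and m :: "'i \<times> nat \<Rightarrow> int"
  proof -
    define S where "S = (\<Sum>l<s i. b ^ p (i, l))"
    have "(\<Sum>j<s i. m (i, j) * y (i, j)) =
        (\<Sum>j<s i. m (i, j) * c i * W + m (i, j) * b ^ p (i, j) - (if j = 0 then m (i, 0) * S else 0))"
      by (intro sum.cong) (auto simp: y_def S_def algebra_simps)
    also have "\<dots> = (\<Sum>j<s i. m (i, j)) * c i * W + (\<Sum>j<s i. m (i, j) * b ^ p (i, j)) - m (i, 0) * S"
      using s[OF i] by (simp add: sum.distrib sum_subtractf sum_distrib_right)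
    also have "\<dots> = (\<Sum>j<s i. m (i, j)) * c i * W + (\<Sum>j<s i. (m (i, j) - m (i, 0)) * b ^ p (i, j))"
      by (simp add: S_def left_diff_distrib sum_subtractf sum_distrib_left)
    finally show ?thesis .
  qed
  have "(\<Sum>j<s i. y (i, j)) = c i * int (s i) * W" if "i \<in> I" for i
    using block[OF that, of "\<lambda>_. 1"] by simp
  moreover
  have "m t = m (fst t, 0)"
    if eq: "(\<Sum>t\<in>T. m t * y t) = E * W" and bd: "\<And>t. t \<in> T \<Longrightarrow> \<bar>m t - m (fst t, 0)\<bar> < b"
      and t: "t \<in> T" for m E t
  proof -
    define N where "N = (\<Sum>i\<in>I. (\<Sum>j<s i. m (i, j)) * c i)"
    define e where "e = (\<lambda>t. m t - m (fst t, 0))"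
    define d where "d = (\<lambda>q. if q < card T then e (the_inv_into T p q) else N - E)"
    have d_p: "d (p u) = e u" if "u \<in> T" for u
      using that p by (auto simp: d_def bij_betw_def the_inv_into_f_f)
    have "(\<Sum>t\<in>T. m t * y t) = (\<Sum>i\<in>I. \<Sum>j<s i. m (i, j) * y (i, j))"
      using assms by (simp add: sum.Sigma)
    also have "\<dots> = (\<Sum>i\<in>I. (\<Sum>j<s i. m (i, j)) * c i * W + (\<Sum>j<s i. e (i, j) * b ^ p (i, j)))"
      by (intro sum.cong) (auto simp: block e_def)
    also have "\<dots> = N * W + (\<Sum>t\<in>T. e t * b ^ p t)"
      using assms by (simp add: sum.distrib N_def sum_distrib_right[of _ _ W] sum.Sigma)
    also have "(\<Sum>t\<in>T. e t * b ^ p t) = (\<Sum>t\<in>T. d (p t) * b ^ p t)"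
      by (intro sum.cong) (auto simp: d_p)
    also have "\<dots> = (\<Sum>q<card T. d q * b ^ q)"
      by (rule sum.reindex_bij_betw[OF p])
    finally have "(\<Sum>q\<le>card T. d q * b ^ q) = 0"
      using eq by (simp add: lessThan_Suc_atMost[symmetric] d_def W_def algebra_simps)
    moreover have "\<bar>d q\<bar> < b" if q: "q < card T" for q
    proof -
      obtain u where "u \<in> T" "q = p u"
        using p q unfolding bij_betw_def by (metis imageE lessThan_iff)
      then show ?thesis
        using bd d_p by (simp add: e_def)
    qed
    moreover have "p t < card T"
      using p t by (auto simp: bij_betw_def)
    ultimately have "d (p t) = 0"
      using base_expansion_eq_zeroD[of "card T" d b "p t"] by simp
    then show ?thesis
      using d_p[OF t] by (simp add: e_def)
  qed
  ultimately show ?thesis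
    using pos by (intro exI[of _ W] exI[of _ y]) blast
qed

section \<open>Blocks without further relations\<close>

lemma sum_mset_eq_sum_count:
  fixes z :: "nat multiset"
  assumes "finite V" and "set_mset z \<subseteq> V"
  shows "sum_mset z = (\<Sum>v\<in>V. count z v * v)"
  using assms(2)
proof (induction z)
  case (add x z)
  have "(\<Sum>v\<in>V. count (add_mset x z) v * v) = (\<Sum>v\<in>V. count z v * v + (if v = x then x else 0))"
    by (intro sum.cong) auto
  then show ?case
    using add assms(1) by (simp add: sum.distrib)
qed simp

text \<open>
  The sizes must be at least 2 for the numbers to be distinct: two blocks of size 1
  with equal sum would coincide.
\<close>

lemma generic_block_family:
  fixes s :: "'i \<Rightarrow> nat"
  assumes "finite I" and "\<forall>i\<in>I. 2 \<le> s i"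
  shows "\<exists>F A. (\<forall>i\<in>I. finite (F i) \<and> card (F i) = s i) \<and>
           disjoint_family_on F I \<and> (0::nat) \<notin> \<Union>(F ` I) \<and>
           (\<forall>z. set_mset z \<subseteq> \<Union>(F ` I) \<longrightarrow>
              sum_mset z = A \<longleftrightarrow> z \<in> (\<lambda>i. mset_set (F i)) ` I)"
proof -
  have s: "2 \<le> s i" if "i \<in> I" for i
    using assms(2) that by blast
  define T where "T = Sigma I (\<lambda>i. {..<s i})"
  define K where "K = (\<Prod>i\<in>I. s i)"
  define c where "c = (\<lambda>i. int (K div s i))"
  \<comment> \<open>Multiplicities will be between \<open>0\<close> and \<open>2 K\<close>, so their differences are digits in this base.\<close>
  define b where "b = 2 * int K + 3"
  have "K > 0"
    unfolding K_def by (intro prod_pos) (use s in fastforce)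
  have dvd: "s i dvd K" if "i \<in> I" for i
    using that assms(1) unfolding K_def by (rule dvd_prodI[rotated])
  have cs: "c i * int (s i) = int K" if "i \<in> I" for i
    using dvd[OF that] by (metis c_def dvd_div_mult_self of_nat_mult)
  have c1: "1 \<le> c i" if "i \<in> I" for i
    using cs[OF that] \<open>K > 0\<close> by (cases "K div s i") (auto simp: c_def)
  have b3: "3 \<le> b"
    by (simp add: b_def)
  have s0: "0 < s i" if "i \<in> I" for i
    using s[OF that] by simp
  obtain W y where W: "W > 0" and low: "\<And>t. t \<in> T \<Longrightarrow> W \<le> 2 * y t"
    and sum_y: "\<And>i. i \<in> I \<Longrightarrow> (\<Sum>j<s i. y (i, j)) = c i * int (s i) * W"
    and rel: "\<And>m E t. (\<Sum>u\<in>T. m u * y u) = E * W \<Longrightarrow>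
           (\<And>u. u \<in> T \<Longrightarrow> \<bar>m u - m (fst u, 0)\<bar> < b) \<Longrightarrow>
           t \<in> T \<Longrightarrow> m t = m (fst t, 0)"
    using generic_block_numbers[of I b c s, OF assms(1) b3 c1 s0, folded T_def] by blast
  have finT: "finite T"
    using assms(1) by (simp add: T_def)
  have y_pos: "y t > 0" if "t \<in> T" for t
    using low[OF that] W by simp
  \<comment> \<open>A coincidence \<open>y t = y t'\<close> is a relation with total \<open>0\<close>; its coefficients would have to be
    constant on the block of \<open>t\<close>, but no element other than \<open>t\<close> has a positive coefficient.\<close>
  have inj: "inj_on y T"
  proof (rule inj_onI, rule ccontr)
    fix t t' assume t: "t \<in> T" and t': "t' \<in> T" and eq: "y t = y t'" and ne: "t \<noteq> t'"
    define m where "m = (\<lambda>u. of_bool (u = t) - of_bool (u = t') :: int)"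
    have "(\<Sum>u\<in>T. m u * y u) = (\<Sum>u\<in>T. (if u = t then y u else 0) - (if u = t' then y u else 0))"
      by (intro sum.cong) (auto simp: m_def)
    also have "\<dots> = 0 * W"
      using t t' eq finT by (simp add: sum_subtractf)
    finally have const: "m u = m (fst u, 0)" if "u \<in> T" for u
      using rel[of m 0 u] that by (auto simp: m_def b_def)
    obtain i j where ij: "t = (i, j)" "i \<in> I"
      using t by (auto simp: T_def)
    define j' where "j' = (if j = 0 then 1 else 0 :: nat)"
    have "(i, j') \<in> T"
      using s[OF ij(2)] ij(2) by (auto simp: T_def j'_def)
    then have "m t = m (i, j')"
      using const t ij by (metis fst_conv)
    moreover have "m t = 1"
      using ne by (simp add: m_def)
    moreover have "m (i, j') \<le> 0"
      using ij by (simp add: m_def j'_def)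
    ultimately show False by simp
  qed
  define x where "x = (\<lambda>t. nat (y t))"
  have x: "int (x t) = y t" if "t \<in> T" for t
    using y_pos[OF that] by (simp add: x_def)
  have inj_x: "inj_on x T"
    using inj x by (metis inj_on_def)
  define F where "F = (\<lambda>i. (\<lambda>j. x (i, j)) ` {..<s i})"
  define A where "A = nat (int K * W)"
  have A: "int A = int K * W"
    using W by (simp add: A_def)
  have UF: "\<Union>(F ` I) = x ` T"
    by (auto simp: F_def T_def)
  have inj_row: "inj_on (\<lambda>j. x (i, j)) {..<s i}" if "i \<in> I" for i
    using inj_x that by (auto simp: inj_on_def T_def)
  have mem_F: "x (i', j) \<in> F i \<longleftrightarrow> i' = i" if "i \<in> I" "(i', j) \<in> T" for i i' j
    using inj_x that by (auto simp: F_def T_def inj_on_def)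
  have sum_F: "int (\<Sum>(F i)) = int K * W" if i: "i \<in> I" for i
  proof -
    have "int (\<Sum>(F i)) = (\<Sum>j<s i. int (x (i, j)))"
      unfolding F_def using inj_row[OF i] by (simp add: sum.reindex)
    also have "\<dots> = (\<Sum>j<s i. y (i, j))"
      using i by (intro sum.cong) (auto simp: x T_def)
    finally show ?thesis
      using sum_y[OF i] cs[OF i] by simp
  qed
  have sols: "sum_mset z = A \<longleftrightarrow> z \<in> (\<lambda>i. mset_set (F i)) ` I"
    if z: "set_mset z \<subseteq> \<Union>(F ` I)" for z
  proof
    assume "z \<in> (\<lambda>i. mset_set (F i)) ` I"
    then obtain i where i: "i \<in> I" "z = mset_set (F i)" by auto
    then show "sum_mset z = A"
      using sum_F[OF i(1)] A by (simp add: sum_unfold_sum_mset del: of_nat_sum of_nat_sum_mset)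
  next
    assume sum: "sum_mset z = A"
    define m where "m = (\<lambda>t. count z (x t))"
    have "sum_mset z = (\<Sum>v\<in>x ` T. count z v * v)"
      using z finT unfolding UF by (intro sum_mset_eq_sum_count) auto
    also have "\<dots> = (\<Sum>t\<in>T. m t * x t)"
      by (simp add: sum.reindex[OF inj_x] m_def)
    finally have "int A = (\<Sum>t\<in>T. int (m t) * int (x t))"
      using sum by simp
    also have "\<dots> = (\<Sum>t\<in>T. int (m t) * y t)"
      by (intro sum.cong) (auto simp: x)
    finally have total: "(\<Sum>t\<in>T. int (m t) * y t) = int K * W"
      using A by simp
    have bound: "m t \<le> 2 * K" if t: "t \<in> T" for t
    proof -
      have "int (m t) * W \<le> int (m t) * (2 * y t)"
        using low[OF t] by (intro mult_left_mono) auto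
      also have "int (m t) * y t \<le> (\<Sum>t\<in>T. int (m t) * y t)"
        using y_pos by (intro member_le_sum[OF t]) (auto simp: less_imp_le finT)
      then have "int (m t) * (2 * y t) \<le> (2 * int K) * W"
        using total by simp
      finally show ?thesis
        using W by (simp add: mult_le_cancel_right)
    qed
    have base: "(i, 0) \<in> T" if "i \<in> I" for i
      using that s0[OF that] by (simp add: T_def)
    have const: "m t = m (fst t, 0)" if t: "t \<in> T" for t
    proof -
      have "\<bar>int (m u) - int (m (fst u, 0))\<bar> < b" if u: "u \<in> T" for u
      proof -
        have "(fst u, 0) \<in> T"
          using u base by (auto simp: T_def)
        then show ?thesis
          using bound[OF u] bound[of "(fst u, 0)"] by (simp add: b_def)
      qed
      then show ?thesis
        using rel[of "\<lambda>t. int (m t)" "int K" t] total t by simp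
    qed
    have row: "m (i, j) = m (i, 0)" if "i \<in> I" "j < s i" for i j
    proof -
      have "(i, j) \<in> T"
        using that by (simp add: T_def)
      from const[OF this] show ?thesis
        by (simp only: fst_conv)
    qed
    have "(\<Sum>t\<in>T. int (m t) * y t) = (\<Sum>i\<in>I. \<Sum>j<s i. int (m (i, j)) * y (i, j))"
      using assms(1) by (simp add: sum.Sigma T_def)
    also have "\<dots> = (\<Sum>i\<in>I. \<Sum>j<s i. int (m (i, 0)) * y (i, j))"
      by (intro sum.cong refl) (metis row lessThan_iff)
    also have "\<dots> = (\<Sum>i\<in>I. int (m (i, 0)) * (int K * W))"
      using sum_y cs by (intro sum.cong refl) (simp add: sum_distrib_left[symmetric])
    also have "\<dots> = int (\<Sum>i\<in>I. m (i, 0)) * (int K * W)"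
      by (simp add: sum_distrib_right)
    finally have "int (\<Sum>i\<in>I. m (i, 0)) = 1"
      using total W \<open>K > 0\<close> by simp
    then have "(\<Sum>i\<in>I. m (i, 0)) = 1"
      by (simp only: of_nat_eq_1_iff)
    then obtain i where i: "i \<in> I" "m (i, 0) = 1" "\<And>i'. i' \<in> I \<Longrightarrow> i \<noteq> i' \<Longrightarrow> m (i', 0) = 0"
      using sum_eq_1_iff[OF assms(1), of "\<lambda>i. m (i, 0)"] by auto
    have "z = mset_set (F i)"
    proof (rule multiset_eqI)
      fix v
      have finF: "finite (F i)"
        by (simp add: F_def)
      show "count z v = count (mset_set (F i)) v"
      proof (cases "v \<in> x ` T")
        case True
        then obtain i' j where t: "(i', j) \<in> T" "v = x (i', j)" by auto
        then have "i' \<in> I" by (simp add: T_def)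
        have "count z v = m (i', 0)"
          using row[of i' j] t by (simp add: m_def T_def)
        also have "\<dots> = of_bool (i' = i)"
          using i \<open>i' \<in> I\<close> by auto
        finally show ?thesis
          using mem_F[OF i(1) t(1)] t(2) finF by (simp add: count_mset_set')
      next
        case False
        then have "v \<notin># z" "v \<notin> F i"
          using z UF i(1) by auto
        then show ?thesis
          by (simp add: count_mset_set' not_in_iff)
      qed
    qed
    then show "z \<in> (\<lambda>i. mset_set (F i)) ` I"
      using i(1) by blast
  qed
  have "disjoint_family_on F I"
    using mem_F inj_x unfolding disjoint_family_on_def
    by (fastforce simp: F_def T_def inj_on_def)
  moreover have "0 \<notin> \<Union>(F ` I)"
    unfolding UF x_def by (fastforce dest: y_pos)
  moreover have "card (F i) = s i" if "i \<in> I" for i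
    using card_image[OF inj_row[OF that]] by (simp add: F_def)
  moreover have "finite (F i)" for i
    by (simp add: F_def)
  ultimately show ?thesis
    using sols by (intro exI[of _ F] exI[of _ A]) blast
qed

section \<open>The numerical monoid of a generic family of blocks\<close>

text \<open>
  The blocks being the only multisets with sum \<open>A\<close> is enough to control the whole monoid up to
  \<open>A\<close>: the exchange of an element for a multiset with the same sum shows that block elements are
  atoms. Conversely, an element of the monoid up to \<open>A\<close> is a sum of block elements, so it is
  an atom only if it is one of them; hence every factorization of \<open>A\<close> is a multiset of block
  elements.
\<close>

lemma numerical_monoid_from_blocks:
  fixes P :: "nat set set" and A :: nat
  assumes "finite P" and fin: "\<And>B. B \<in> P \<Longrightarrow> finite B" and "disjoint P"
    and card: "\<And>B. B \<in> P \<Longrightarrow> 2 \<le> card B" and pos: "0 \<notin> \<Union>P"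
    and sols: "\<And>z. set_mset z \<subseteq> \<Union>P \<Longrightarrow> sum_mset z = A \<longleftrightarrow> z \<in> mset_set ` P"
    and "P \<noteq> {}"
  shows "\<exists>H. numerical_monoid H \<and> squarefree_in H A \<and> factorizations H A = mset_set ` P"
proof -
  define S where "S = {sum_mset z | z. set_mset z \<subseteq> \<Union>P}"
  define H where "H = S \<union> {A<..}"
  have S_add: "x + y \<in> S" if xy: "x \<in> S" "y \<in> S" for x y
  proof -
    obtain z z' where "set_mset z \<subseteq> \<Union>P" "x = sum_mset z" "set_mset z' \<subseteq> \<Union>P" "y = sum_mset z'"
      using xy by (auto simp: S_def)
    then show ?thesis
      unfolding S_def by (intro CollectI exI[of _ "z + z'"]) auto
  qed
  have S_0: "0 \<in> S"
    unfolding S_def by (intro CollectI exI[of _ "{#}"]) simp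
  have "- H \<subseteq> {..A}"
    by (auto simp: H_def)
  then have num: "numerical_monoid H"
    using S_add S_0 unfolding numerical_monoid_def H_def
    by (auto intro: finite_subset)
  have small: "\<exists>z. set_mset z \<subseteq> \<Union>P \<and> x = sum_mset z" if "x \<in> H" "x \<le> A" for x
    using that by (auto simp: H_def S_def)
  have block_sum: "\<Sum>B = A" if "B \<in> P" for B
  proof -
    have "sum_mset (mset_set B) = A"
      using sols[of "mset_set B"] that fin[OF that] by auto
    then show ?thesis by (simp add: sum_unfold_sum_mset)
  qed
  have le: "u \<le> A" if u: "u \<in> \<Union>P" for u
  proof -
    obtain B where B: "B \<in> P" "u \<in> B"
      using u by auto
    then show ?thesis
      using member_le_sum[of u B "\<lambda>x. x"] block_sum[of B] fin[of B] by auto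
  qed
  \<comment> \<open>The exchange argument: replace \<open>u\<close> in its block \<open>B\<close> by \<open>z\<close>.\<close>
  have single: "z = {#u#}" if u: "u \<in> \<Union>P" and z: "set_mset z \<subseteq> \<Union>P" "sum_mset z = u" for u z
  proof -
    obtain B where B: "B \<in> P" "u \<in> B"
      using u by auto
    have finB: "finite B"
      using B fin by auto
    define z' where "z' = mset_set (B - {u}) + z"
    have "sum_mset z' = \<Sum>(B - {u}) + u"
      by (simp add: z'_def z(2) sum_unfold_sum_mset)
    also have "\<dots> = A"
      using block_sum[OF B(1)] sum.remove[OF finB B(2), of "\<lambda>x. x"] by simp
    finally have "sum_mset z' = A" .
    moreover have "set_mset z' \<subseteq> \<Union>P"
      using finB z B by (auto simp: z'_def)
    ultimately obtain B' where B': "B' \<in> P" "z' = mset_set B'"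
      using sols by auto
    have "card (B - {u}) \<noteq> 0"
      using card[OF B(1)] B(2) by simp
    then have "B - {u} \<noteq> {}"
      by (metis card.empty)
    then obtain v where v: "v \<in> B" "v \<noteq> u"
      by auto
    then have "v \<in># z'"
      using finB by (simp add: z'_def)
    then have "v \<in> B'"
      using B' fin by auto
    then have "B' = B"
      using \<open>disjoint P\<close> B B' v by (auto simp: disjoint_def)
    then have "mset_set (B - {u}) + z = mset_set (B - {u}) + {#u#}"
      using B' mset_set.remove[OF finB B(2)] by (simp add: z'_def)
    then show ?thesis by simp
  qed
  have in_S: "u \<in> S" if "u \<in> \<Union>P" for u
    unfolding S_def using that by (intro CollectI exI[of _ "{#u#}"]) auto
  have atom_le: "u \<in> \<Union>P" if u: "u \<in> atoms H" "u \<le> A" for u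
  proof -
    have uH: "u \<in> H" "u \<noteq> 0"
      using u by (auto simp: atoms_def)
    obtain z where z: "set_mset z \<subseteq> \<Union>P" "u = sum_mset z"
      using small uH u(2) by blast
    with uH have "z \<noteq> {#}" by auto
    then obtain v z1 where z1: "z = add_mset v z1"
      using multiset_cases by blast
    have v: "v \<in> \<Union>P" using z z1 by auto
    then have "v \<in> H" "v \<noteq> 0"
      using in_S pos by (auto simp: H_def)
    moreover have "sum_mset z1 \<in> H"
      using z z1 by (auto simp: H_def S_def)
    moreover have "u = v + sum_mset z1"
      using z z1 by simp
    ultimately have "sum_mset z1 = 0"
      using u(1) unfolding atoms_def by blast
    with \<open>u = v + sum_mset z1\<close> have "u = v"
      by simp
    then show ?thesis
      using v by simp
  qed
  have atomI: "u \<in> atoms H" if u: "u \<in> \<Union>P" for u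
  proof -
    have False if xy: "x \<in> H" "y \<in> H" "x \<noteq> 0" "y \<noteq> 0" "u = x + y" for x y
    proof -
      have "x \<le> A" "y \<le> A"
        using le[OF u] xy by auto
      then obtain z z' where z: "set_mset z \<subseteq> \<Union>P" "x = sum_mset z"
          and z': "set_mset z' \<subseteq> \<Union>P" "y = sum_mset z'"
        using small[of x] small[of y] xy by blast
      then have "z + z' = {#u#}"
        using single[OF u, of "z + z'"] xy(5) by simp
      then have "z = {#} \<or> z' = {#}"
        by (simp add: union_is_single)  blast
      then show False
        using xy z z' by auto
    qed
    moreover have "u \<in> H" "u \<noteq> 0"
      using u in_S pos by (auto simp: H_def)
    ultimately show ?thesis
      unfolding atoms_def by blast
  qed
  have "factorizations H A = mset_set ` P"
  proof (intro set_eqI iffI)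
    fix z assume "z \<in> factorizations H A"
    then have z: "set_mset z \<subseteq> atoms H" "sum_mset z = A"
      by (auto simp: factorizations_def factorization_monoid_def)
    have "set_mset z \<subseteq> \<Union>P"
    proof
      fix u assume "u \<in># z"
      then have "u \<le> A"
        using z(2) multi_member_split[of u z] by auto
      then show "u \<in> \<Union>P"
        using atom_le z(1) \<open>u \<in># z\<close> by blast
    qed
    then show "z \<in> mset_set ` P"
      using sols z by blast
  next
    fix z assume z: "z \<in> mset_set ` P"
    then have sub: "set_mset z \<subseteq> \<Union>P"
      using fin by auto
    then show "z \<in> factorizations H A"
      using z sols[OF sub] atomI by (auto simp: factorizations_def factorization_monoid_def)
  qed
  moreover have "squarefree_in H A"
  proof -
    have False if bc: "b \<in> H" "c \<in> H" "b \<noteq> 0" "A = b + b + c" for b c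
    proof -
      have "b \<le> A" "c \<le> A"
        using bc by auto
      then obtain z z' where z: "set_mset z \<subseteq> \<Union>P" "b = sum_mset z"
          and z': "set_mset z' \<subseteq> \<Union>P" "c = sum_mset z'"
        using small[of b] small[of c] bc by blast
      then have "z + z + z' \<in> mset_set ` P"
        using sols[of "z + z + z'"] bc(4) by simp
      then obtain B where B: "B \<in> P" "z + z + z' = mset_set B"
        by auto
      obtain v where v: "v \<in># z"
        using bc(3) z by fastforce
      have "1 \<le> count z v"
        using v by simp
      then have "count (z + z + z') v \<ge> 2"
        unfolding count_union by linarith
      then show False
        using B fin[OF B(1)] by (auto simp: count_mset_set' split: if_splits)
    qed
    moreover have "A \<in> H"
    proof -
      obtain B where B: "B \<in> P" using \<open>P \<noteq> {}\<close> by auto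
      then show ?thesis
        unfolding H_def S_def using sols[of "mset_set B"] fin[OF B]
        by (intro UnI1 CollectI exI[of _ "mset_set B"]) auto
    qed
    ultimately show ?thesis
      unfolding squarefree_in_def by blast
  qed
  ultimately show ?thesis
    using num by blast
qed

section \<open>Prescribed lengths with multiplicities\<close>

theorem theorem3p3:
  fixes L :: "nat set" and f :: "nat \<Rightarrow> nat"
  assumes "finite L" and "L \<noteq> {}" and "\<forall>k\<in>L. 2 \<le> k"
    and "\<forall>k\<in>L. 1 \<le> f k"
  shows "\<exists>H a. numerical_monoid H \<and> squarefree_in H a \<and>
           length_set H a = L \<and>
           (\<forall>k\<in>L. card (factorizations_of_length H k a) = f k)"
proof -
  \<comment> \<open>One block of size \<open>k\<close> for each of the \<open>f k\<close> factorizations of length \<open>k\<close>.\<close>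
  define I where "I = Sigma L (\<lambda>k. {..<f k})"
  have finI: "finite I"
    using assms(1) by (simp add: I_def)
  have I2: "\<forall>i\<in>I. 2 \<le> fst i"
    using assms(3) by (auto simp: I_def)
  obtain F :: "nat \<times> nat \<Rightarrow> nat set" and A where F: "\<forall>i\<in>I. finite (F i) \<and> card (F i) = fst i"
    and disj: "disjoint_family_on F I" and zero: "0 \<notin> \<Union>(F ` I)"
    and sols: "\<forall>z. set_mset z \<subseteq> \<Union>(F ` I) \<longrightarrow>
           sum_mset z = A \<longleftrightarrow> z \<in> (\<lambda>i. mset_set (F i)) ` I"
    using generic_block_family[of I fst, OF finI I2] by blast
  have finF: "finite (F i)" and cardF: "card (F i) = fst i" if "i \<in> I" for i
    using F that by auto
  have lengths: "fst ` I = L"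
  proof -
    have "fst ` I = {k \<in> L. {..<f k} \<noteq> {}}"
      unfolding I_def by (rule fst_image_Sigma)
    then show ?thesis
      using assms(4) by (force simp: lessThan_empty_iff)
  qed
  have "I \<noteq> {}"
    using lengths assms(2) by auto
  have dP: "disjoint (F ` I)"
    using disj by (rule disjoint_family_on_disjoint_image)
  obtain H where H: "numerical_monoid H" "squarefree_in H A"
    and fac: "factorizations H A = mset_set ` F ` I"
  proof -
    have "\<exists>H. numerical_monoid H \<and> squarefree_in H A \<and> factorizations H A = mset_set ` F ` I"
    proof (rule numerical_monoid_from_blocks)
      show "sum_mset z = A \<longleftrightarrow> z \<in> mset_set ` F ` I" if "set_mset z \<subseteq> \<Union>(F ` I)" for z
        using sols that by (simp add: image_image)
    qed (use finI finF cardF I2 dP zero \<open>I \<noteq> {}\<close> in auto)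
    then show ?thesis
      using that by blast
  qed
  define Z where "Z = (\<lambda>i. mset_set (F i))"
  have fac_Z: "factorizations H A = Z ` I"
    using fac by (simp add: image_image Z_def)
  have size_Z: "size (Z i) = fst i" if "i \<in> I" for i
    using cardF[OF that] by (simp add: Z_def)
  have inj: "inj_on Z I"
  proof (rule inj_onI)
    fix i i' assume i: "i \<in> I" "i' \<in> I" and "Z i = Z i'"
    then have "F i = F i'"
      using finF by (metis Z_def finite_set_mset_mset_set)
    moreover have "F i \<noteq> {}"
      using cardF[OF i(1)] I2 i(1) by auto
    ultimately show "i = i'"
      using disj i by (auto simp: disjoint_family_on_def)
  qed
  have "length_set H A = L"
    unfolding length_set_def fac_Z using lengths size_Z by (simp add: image_image cong: image_cong)
  moreover have "card (factorizations_of_length H k A) = f k" if "k \<in> L" for k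
  proof -
    have "factorizations_of_length H k A = Z ` {i \<in> I. fst i = k}"
      using size_Z by (auto simp: factorizations_of_length_def fac_Z)
    also have "{i \<in> I. fst i = k} = {k} \<times> {..<f k}"
      using that by (auto simp: I_def)
    finally have "factorizations_of_length H k A = Z ` ({k} \<times> {..<f k})" .
    moreover have "inj_on Z ({k} \<times> {..<f k})"
      using that by (intro inj_on_subset[OF inj]) (auto simp: I_def)
    ultimately show ?thesis
      by (simp add: card_image card_cartesian_product)
  qed
  ultimately show ?thesis
    using H by blast
qed

end
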